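(* Let $a\in\mathbb{R}$, let $f\in E$ and let $x>a$. Then $$\lim_{\varepsilon\to0^+}D^{1-\varepsilon}(f)(x)=\frac{d}{dx}f(x).$$
   Context: $E$ denotes the set of integrable and derivable (differentiable) causal functions $f$ on the interval $I=\,]a,+\infty[$. Causal means that $f$ vanishes to the left of $a$; the value $f(a)$ may be zero or nonzero. Integrable means that $\int_a^x f(t)\,dt$ exists for every $x>a$ as a Lebesgue integral. For $0<s<1$ the $s$-order derivative operator is $$D^s(f)(x)=\frac{1}{\Gamma(1-s)}\frac{d}{dx}\int_a^x (x-y)^{-s}f(y)\,dy,\qquad x>a,$$ where $\Gamma$ is Euler's gamma function; thus for $0<\varepsilon<1$, $$D^{1-\varepsilon}(f)(x)=\frac{1}{\Gamma(\varepsilon)}\frac{d}{dx}\int_a^x (x-y)^{\varepsilon-1}f(y)\,dy.$$ *)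

theory Defs
  imports "HOL-Analysis.Analysis"
begin

text \<open>
  Differentiable, locally integrable causal functions on \<open>]a, \<infinity>[\<close>; causality fixes \<open>f\<close>
  only strictly to the left of \<open>a\<close>, so \<open>f a\<close> is arbitrary.
\<close>

definition causal_space :: "real \<Rightarrow> (real \<Rightarrow> real) set" where
  "causal_space a = {f. (\<forall>x<a. f x = 0) \<and>
                        (\<forall>x>a. f differentiable (at x)) \<and>
                        (\<forall>x>a. set_integrable lebesgue {a<..<x} f)}"

definition frac_kernel_integral :: "real \<Rightarrow> real \<Rightarrow> (real \<Rightarrow> real) \<Rightarrow> real \<Rightarrow> real" where
  "frac_kernel_integral a s f x = (LINT y:{a<..<x}|lebesgue. (x - y) powr (- s) * f y)"

definition frac_deriv :: "real \<Rightarrow> real \<Rightarrow> (real \<Rightarrow> real) \<Rightarrow> real \<Rightarrow> real" where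
  "frac_deriv a s f x = 1 / Gamma (1 - s) * deriv (frac_kernel_integral a s f) x"

text \<open>
  Both the Lebesgue integral and \<^const>\<open>deriv\<close> are total in HOL; the following predicate says
  that the value of \<^const>\<open>frac_deriv\<close> at \<open>x\<close> is genuine, i.e. the integrals converge and
  the outer derivative exists.
\<close>

definition frac_deriv_exists :: "real \<Rightarrow> real \<Rightarrow> (real \<Rightarrow> real) \<Rightarrow> real \<Rightarrow> bool" where
  "frac_deriv_exists a s f x \<longleftrightarrow>
     (\<forall>z>a. set_integrable lebesgue {a<..<z} (\<lambda>y. (z - y) powr (- s) * f y)) \<and>
     frac_kernel_integral a s f differentiable (at x)"

end

theory Submission
  imports Defs
begin

text \<open>
  Near \<open>x\<close> the difference \<open>g y = f y - f x\<close> is \<open>O(\<bar>y - x\<bar>)\<close>. This alone lets one differentiate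
  \<open>\<integral> (z - y)\<^sub>+\<^sup>\<epsilon>\<^sup>-\<^sup>1 g y dy\<close> at \<open>z = x\<close> under the integral sign: in the difference quotient with
  increment \<open>h\<close>, the part \<open>\<bar>y - x\<bar> \<le> 2\<bar>h\<bar>\<close> contributes only \<open>O(\<bar>h\<bar>\<^sup>\<epsilon>)\<close>, and on the rest the integrand is
  dominated by a constant times \<open>(x - y)\<^sub>+\<^sup>\<epsilon>\<^sup>-\<^sup>2 \<bar>g y\<bar>\<close>. Integrating the constant \<open>f x\<close> explicitly gives
  \<open>\<Gamma>(\<epsilon>) D\<^sup>1\<^sup>-\<^sup>\<epsilon> f x = f x (x - a)\<^sup>\<epsilon>\<^sup>-\<^sup>1 + (\<epsilon> - 1) \<integral> (x - y)\<^sub>+\<^sup>\<epsilon>\<^sup>-\<^sup>2 g y dy\<close>. Since \<open>1 / \<Gamma>(\<epsilon>) \<sim> \<epsilon>\<close>, only the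
  mass of \<open>\<epsilon> (x - y)\<^sub>+\<^sup>\<epsilon>\<^sup>-\<^sup>1\<close> matters in the limit; it concentrates at \<open>x\<close>, where
  \<open>g y / (x - y)\<close> tends to \<open>- f' x\<close>.
\<close>

section \<open>Truncated powers and their integrals\<close>

text \<open>As a kernel in \<open>z - y\<close>, the cut-off at 0 moves the variable upper limit
  \<open>z\<close> into the integrand, so the domain of integration can be kept independent of
  \<open>z\<close>.\<close>

definition tpow :: "real \<Rightarrow> real \<Rightarrow> real" where
  "tpow p t = (if t > 0 then t powr p else 0)"

lemma tpow_nonneg: "tpow p t \<ge> 0"
  by (simp add: tpow_def)

lemma tpow_measurable [measurable]: "tpow p \<in> borel_measurable borel"
  unfolding tpow_def by measurable

text \<open>Since \<open>p + 1 > 0\<close>, the primitive is continuous up to \<open>z\<close>, so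
  the fundamental theorem with derivatives only in the interior applies even where the kernel blows
  up at \<open>z\<close>. Beyond \<open>z\<close> the kernel vanishes, hence no \<open>d\<close> in
  the value.\<close>

lemma has_integral_tpow:
  fixes c z d p :: real
  assumes "p > -1" "c \<le> z" "z \<le> d"
  shows "((\<lambda>y. tpow p (z - y)) has_integral (z - c) powr (p + 1) / (p + 1)) {c..d}"
proof -
  define F where "F = (\<lambda>y. - ((z - y) powr (p + 1)) / (p + 1))"
  have "((\<lambda>y. tpow p (z - y)) has_integral F z - F c) {c..z}"
  proof (rule fundamental_theorem_of_calculus_interior)
    show "continuous_on {c..z} F"
      unfolding F_def using assms by (intro continuous_intros continuous_on_powr') auto
    show "(F has_vector_derivative tpow p (z - y)) (at y)" if "y \<in> {c<..<z}" for y
    proof -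
      have "(F has_real_derivative (z - y) powr p) (at y)"
        unfolding F_def using that assms by (auto intro!: derivative_eq_intros)
      then show ?thesis
        using that by (simp add: tpow_def has_real_derivative_iff_has_vector_derivative)
    qed
  qed fact
  moreover have "((\<lambda>y. tpow p (z - y)) has_integral 0) {z..d}"
    by (rule has_integral_is_0) (auto simp: tpow_def)
  ultimately have "((\<lambda>y. tpow p (z - y)) has_integral F z - F c + 0) {c..d}"
    by (rule has_integral_combine[OF assms(2,3)])
  then show ?thesis
    by (simp add: F_def)
qed

lemma has_integral_tpow_greaterThanLessThan:
  fixes c z d p :: real
  assumes "p > -1" "c \<le> z" "z \<le> d"
  shows "((\<lambda>y. tpow p (z - y)) has_integral (z - c) powr (p + 1) / (p + 1)) {c<..<d}"
  using has_integral_tpow[OF assms] has_integral_Icc_iff_Ioo by blast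

section \<open>Integrability and bounds for a truncated power times a function\<close>

context
  fixes a b z d p q M :: real and f :: "real \<Rightarrow> real"
  assumes f: "f absolutely_integrable_on {a<..<b}"
    and zb: "a \<le> z" "z \<le> b"
    and d: "d > 0"
    and M: "M \<ge> 0"
    and near: "\<And>y. a < y \<Longrightarrow> z - d < y \<Longrightarrow> y < z \<Longrightarrow> \<bar>f y\<bar> \<le> M * (z - y) powr q"
    and pq: "p \<le> 0" "p + q > -1"
begin

text \<open>Within distance \<open>d\<close> to the left of \<open>z\<close>, the growth bound
  raises the exponent to \<open>p + q\<close>; farther left, \<open>(z - y) powr p\<close> is at
  most \<open>d powr p\<close> because \<open>p \<le> 0\<close>. The later uses are
  \<open>q = 0\<close> with \<open>p = e - 1\<close> for locally bounded factors, and
  \<open>q = 1\<close> with \<open>p = e - 2\<close> for factors vanishing linearly at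
  \<open>z\<close>.\<close>

lemma tpow_mult_bound:
  assumes "y \<in> {a<..<b}"
  shows "\<bar>tpow p (z - y) * f y\<bar> \<le> M * tpow (p + q) (z - y) + d powr p * \<bar>f y\<bar>"
proof -
  consider "y \<ge> z" | "z - d < y" "y < z" | "y \<le> z - d" by linarith
  then show ?thesis
  proof cases
    case 1
    then show ?thesis by (simp add: tpow_def)
  next
    case 2
    have "(z - y) powr p * \<bar>f y\<bar> \<le> (z - y) powr p * (M * (z - y) powr q)"
      using near[of y] assms 2 by (intro mult_left_mono) auto
    also have "\<dots> = M * (z - y) powr (p + q)"
      by (simp add: powr_add)
    finally show ?thesis
      using 2 by (simp add: tpow_def abs_mult add_increasing2)
  next
    case 3
    have "(z - y) powr p \<le> d powr p"
      using 3 d pq by (intro powr_mono2') auto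
    then have "(z - y) powr p * \<bar>f y\<bar> \<le> d powr p * \<bar>f y\<bar>"
      by (intro mult_right_mono) auto
    moreover have "y < z" using 3 d by simp
    ultimately show ?thesis
      using M by (simp add: tpow_def abs_mult add_increasing)
  qed
qed

lemma tpow_mult_bound_has_integral:
  "((\<lambda>y. M * tpow (p + q) (z - y) + d powr p * \<bar>f y\<bar>) has_integral
     M * ((z - a) powr (p + q + 1) / (p + q + 1)) + d powr p * integral {a<..<b} (\<lambda>y. \<bar>f y\<bar>)) {a<..<b}"
proof (intro has_integral_add has_integral_mult_right)
  show "((\<lambda>y. tpow (p + q) (z - y)) has_integral (z - a) powr (p + q + 1) / (p + q + 1)) {a<..<b}"
    using has_integral_tpow_greaterThanLessThan[OF pq(2) zb] .
  show "((\<lambda>y. \<bar>f y\<bar>) has_integral integral {a<..<b} (\<lambda>y. \<bar>f y\<bar>)) {a<..<b}"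
    using f by (intro integrable_integral) (auto simp: absolutely_integrable_on_def)
qed

lemma tpow_mult_absolutely_integrable:
  "(\<lambda>y. tpow p (z - y) * f y) absolutely_integrable_on {a<..<b}"
proof (rule measurable_bounded_by_integrable_imp_absolutely_integrable)
  have "f \<in> borel_measurable (lebesgue_on {a<..<b})"
    using f by (simp add: absolutely_integrable_measurable)
  moreover have "(\<lambda>y. tpow p (z - y)) \<in> borel_measurable (lebesgue_on {a<..<b})"
    by (rule measurable_restrict_space1, rule measurable_completion) measurable
  ultimately show "(\<lambda>y. tpow p (z - y) * f y) \<in> borel_measurable (lebesgue_on {a<..<b})"
    by (intro borel_measurable_times)
  show "(\<lambda>y. M * tpow (p + q) (z - y) + d powr p * \<bar>f y\<bar>) integrable_on {a<..<b}"
    using tpow_mult_bound_has_integral by (rule has_integral_integrable)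
qed (use tpow_mult_bound in auto)

text \<open>The explicit \<open>M\<close> is what the limit argument needs: there \<open>M\<close>
  is arbitrarily small and \<open>p + q + 1 = e\<close>, so \<open>e\<close> times the first term
  remains of order \<open>M\<close>.\<close>

lemma integral_tpow_mult_bound:
  "\<bar>integral {a<..<b} (\<lambda>y. tpow p (z - y) * f y)\<bar> \<le>
     M * ((z - a) powr (p + q + 1) / (p + q + 1)) + d powr p * integral {a<..<b} (\<lambda>y. \<bar>f y\<bar>)"
proof -
  have "norm (integral {a<..<b} (\<lambda>y. tpow p (z - y) * f y)) \<le>
        integral {a<..<b} (\<lambda>y. M * tpow (p + q) (z - y) + d powr p * \<bar>f y\<bar>)"
    using tpow_mult_absolutely_integrable tpow_mult_bound_has_integral tpow_mult_bound
    by (intro integral_norm_bound_integral) (auto simp: absolutely_integrable_on_def)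
  then show ?thesis
    using integral_unique[OF tpow_mult_bound_has_integral] by simp
qed

end

section \<open>Derivative and increments of truncated powers\<close>

lemma tpow_has_real_derivative:
  assumes "t \<noteq> 0"
  shows "(tpow p has_real_derivative p * tpow (p - 1) t) (at t)"
proof (cases "t > 0")
  case True
  have "((\<lambda>t. t powr p) has_real_derivative p * t powr (p - 1)) (at t)"
    using True by (auto intro!: derivative_eq_intros)
  then show ?thesis
    using True by (auto simp: tpow_def elim!: has_field_derivative_transform_within_open[where S = "{0<..}"])
next
  case False
  have "((\<lambda>t. 0) has_real_derivative 0) (at t)" by simp
  then have "(tpow p has_real_derivative 0) (at t)"
    by (rule has_field_derivative_transform_within_open[where S = "{..<0}"])
      (use False assms in \<open>auto simp: tpow_def\<close>)
  then show ?thesis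
    using False by (simp add: tpow_def)
qed

text \<open>For \<open>t > 0\<close> both \<open>t\<close> and \<open>t + h\<close> lie in
  \<open>{t/2..}\<close>, where the derivative is largest at \<open>t/2\<close>; the mean value
  inequality then yields the factor \<open>2 powr (1 - p)\<close>. For \<open>t < 0\<close> both
  values are 0.\<close>

lemma tpow_diff_bound:
  assumes "p \<le> 1" "\<bar>t\<bar> \<ge> 2 * \<bar>h\<bar>" "t \<noteq> 0"
  shows "\<bar>tpow p (t + h) - tpow p t\<bar> \<le> \<bar>p\<bar> * 2 powr (1 - p) * tpow (p - 1) t * \<bar>h\<bar>"
proof (cases "t > 0")
  case True
  have D: "(tpow p has_field_derivative p * tpow (p - 1) u) (at u within {t/2..})"
    if "u \<in> {t/2..}" for u
    using that True by (simp add: has_field_derivative_at_within[OF tpow_has_real_derivative])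
  have B: "norm (p * tpow (p - 1) u) \<le> \<bar>p\<bar> * (t / 2) powr (p - 1)" if u: "u \<in> {t/2..}" for u
  proof -
    have "u > 0" using u True by simp
    moreover have "u powr (p - 1) \<le> (t / 2) powr (p - 1)"
      using u True assms(1) by (intro powr_mono2') simp_all
    ultimately show ?thesis
      by (simp add: tpow_def abs_mult mult_left_mono)
  qed
  have "t \<in> {t/2..}" "t + h \<in> {t/2..}"
    using assms(2) True by (auto simp: abs_if split: if_splits)
  then have "norm (tpow p (t + h) - tpow p t) \<le> (\<bar>p\<bar> * (t / 2) powr (p - 1)) * norm (t + h - t)"
    by (intro field_differentiable_bound[OF _ D B]) simp_all
  also have "(t / 2) powr (p - 1) = 2 powr (1 - p) * tpow (p - 1) t"
  proof -
    have "2 powr (1 - p) = 1 / 2 powr (p - 1)"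
      using powr_minus_divide[of 2 "p - 1"] by simp
    then show ?thesis
      using True by (simp add: tpow_def powr_divide)
  qed
  finally show ?thesis
    by (simp add: mult_ac)
next
  case False
  then have "t < 0" "t + h \<le> 0"
    using assms(2,3) by (auto simp: abs_if split: if_splits)
  then show ?thesis
    by (simp add: tpow_def)
qed

section \<open>Differentiation under the integral sign\<close>

text \<open>The differentiated kernel has exponent \<open>e - 2 < -1\<close>; only the linear
  vanishing of \<open>g\<close> at \<open>x\<close> makes the product integrable. The difference
  quotient is singular at \<open>x\<close> and at the moving point \<open>x + h\<close>, so
  domination is used only outside the window \<open>T h\<close>, which contains both.\<close>

lemma integral_tpow_mult_has_real_derivative:
  fixes a b x e C d :: real and g :: "real \<Rightarrow> real"
  assumes g: "g absolutely_integrable_on {a<..<b}"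
    and x: "a < x" "x < b" and e: "0 < e" "e < 1"
    and C: "C \<ge> 0" and d0: "d > 0"
    and near: "\<And>y. \<bar>y - x\<bar> < d \<Longrightarrow> \<bar>g y\<bar> \<le> C * \<bar>y - x\<bar>"
  shows "((\<lambda>z. integral {a<..<b} (\<lambda>y. tpow (e - 1) (z - y) * g y)) has_real_derivative
          (e - 1) * integral {a<..<b} (\<lambda>y. tpow (e - 2) (x - y) * g y)) (at x)"
proof -
  define S where "S = {a<..<b}"
  define r where "r = min d (min (x - a) (b - x))"
  define T where "T = (\<lambda>h. {x - 2 * \<bar>h\<bar>..x + 2 * \<bar>h\<bar>})"
  define J where "J = (\<lambda>z. integral S (\<lambda>y. tpow (e - 1) (z - y) * g y))"
  define q where "q = (\<lambda>h y. (tpow (e - 1) (x + h - y) - tpow (e - 1) (x - y)) / h * g y)"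
  \<comment> \<open>For \<open>h\<close> in \<open>U\<close>, \<open>2 * \<bar>h\<bar> < r\<close>,
    so \<open>T h\<close> stays inside \<open>S\<close> and in the range of the linear bound on
    \<open>g\<close>.\<close>
  define U where "U = {- (r / 3)<..<r / 3}"
  have r: "r > 0" "r \<le> d" "r \<le> x - a" "r \<le> b - x"
    using d0 x by (auto simp: r_def)
  have T_sub: "T h \<subseteq> S" "\<And>y. y \<in> T h \<Longrightarrow> \<bar>y - x\<bar> < d" "\<bar>h\<bar> < r" if "h \<in> U" for h
    using that r by (auto simp: T_def S_def U_def abs_if split: if_splits)
  have k_int: "(\<lambda>y. tpow (e - 1) (z - y) * g y) absolutely_integrable_on S" if "\<bar>z - x\<bar> < r" for z
    unfolding S_def
  \<comment> \<open>This \<open>d\<close> keeps the points just left of \<open>z\<close> within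
    \<open>r\<close> of \<open>x\<close>, where \<open>g\<close> is bounded by
    \<open>C * r\<close>.\<close>
  proof (rule tpow_mult_absolutely_integrable[where d = "r - \<bar>z - x\<bar>" and q = 0 and M = "C * r"])
    fix y assume y: "z - (r - \<bar>z - x\<bar>) < y" "y < z"
    then have "\<bar>y - x\<bar> < r"
      by linarith
    moreover from this have "C * \<bar>y - x\<bar> \<le> C * r"
      using C by (intro mult_left_mono) auto
    ultimately show "\<bar>g y\<bar> \<le> C * r * (z - y) powr 0"
      using near[of y] y r by simp
  qed (use g that r e C in auto)
  have sing_int: "(\<lambda>y. tpow (e - 2) (x - y) * g y) absolutely_integrable_on S"
    unfolding S_def
  proof (rule tpow_mult_absolutely_integrable[where d = d and q = 1 and M = C])
    show "\<bar>g y\<bar> \<le> C * (x - y) powr 1" if "x - d < y" "y < x" for y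
      using near[of y] that by simp
  qed (use g e C x d0 in auto)
  have q_int: "q h absolutely_integrable_on S" if "h \<in> U" for h
  proof -
    have "(\<lambda>y. (1 / h) * (tpow (e - 1) (x + h - y) * g y - tpow (e - 1) (x - y) * g y))
          absolutely_integrable_on S"
      using T_sub(3)[OF that] r
      by (intro set_integrable_mult_right set_integral_diff(1) k_int) auto
    then show ?thesis
      by (simp add: q_def algebra_simps diff_divide_distrib)
  qed
  \<comment> \<open>The outer part is extended by zero to the fixed set \<open>S\<close>, the form
    that dominated convergence requires.\<close>
  have J_diff: "(J (x + h) - J x) / h = integral (T h) (q h) + integral S (\<lambda>y. if y \<in> S - T h then q h y else 0)"
    if h: "h \<in> U" for h
  proof -
    have "q h absolutely_integrable_on T h" "q h absolutely_integrable_on S - T h"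
      using T_sub[OF h] by (auto intro!: set_integrable_subset[OF q_int[OF h]] simp: T_def S_def)
    then have i: "q h integrable_on T h" "q h integrable_on S - T h"
      by (auto simp: absolutely_integrable_on_def)
    have 1: "(q h has_integral integral (T h) (q h) + integral (S - T h) (q h)) (T h \<union> (S - T h))"
      using i by (intro has_integral_Un integrable_integral) auto
    have 2: "T h \<union> (S - T h) = S"
      using T_sub(1)[OF h] by auto
    have 3: "integral (S - T h) (q h) = integral S (\<lambda>y. if y \<in> S - T h then q h y else 0)"
      unfolding integral_restrict_Int by (simp add: Int_absorb2)
    have 4: "(q h has_integral (1 / h) * (J (x + h) - J x)) S"
    proof -
      have "((\<lambda>y. (1 / h) * (tpow (e - 1) (x + h - y) * g y - tpow (e - 1) (x - y) * g y))
          has_integral (1 / h) * (J (x + h) - J x)) S"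
        unfolding J_def using T_sub(3)[OF h] r
        by (intro has_integral_mult_right has_integral_diff integrable_integral
                  set_lebesgue_integral_eq_integral(1)[OF k_int]) auto
      then show ?thesis
        by (simp add: q_def algebra_simps diff_divide_distrib)
    qed
    show ?thesis
      using has_integral_unique[OF 4 1[unfolded 2]] 3 by simp
  qed
  \<comment> \<open>\<open>\<bar>g\<bar> \<le> 2 C \<bar>h\<bar>\<close> on \<open>T h\<close> cancels the factor \<open>1 / h\<close> of the difference quotient.\<close>
  have near_bound: "\<bar>integral (T h) (q h)\<bar> \<le> 4 * C * ((3 * \<bar>h\<bar>) powr e / e)" if h: "h \<in> U" "h \<noteq> 0" for h
  proof -
    let ?K = "\<lambda>z. (z - (x - 2 * \<bar>h\<bar>)) powr e / e"
    let ?B = "\<lambda>y. 2 * C * (tpow (e - 1) (x + h - y) + tpow (e - 1) (x - y))"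
    have K: "((\<lambda>y. tpow (e - 1) (z - y)) has_integral ?K z) (T h)"
      if "z \<in> T h" for z
      using has_integral_tpow[of "e - 1" "x - 2 * \<bar>h\<bar>" z "x + 2 * \<bar>h\<bar>"] that e
      by (auto simp: T_def)
    have "x + h \<in> T h" "x \<in> T h"
      by (auto simp: T_def)
    then have B: "(?B has_integral 2 * C * (?K (x + h) + ?K x)) (T h)"
      by (intro has_integral_mult_right has_integral_add K)
    have "q h absolutely_integrable_on T h"
      using T_sub[OF h(1)] by (auto intro!: set_integrable_subset[OF q_int[OF h(1)]] simp: T_def S_def)
    then have "norm (integral (T h) (q h)) \<le> integral (T h) ?B"
    proof (intro integral_norm_bound_integral)
      fix y assume y: "y \<in> T h"
      let ?s = "tpow (e - 1) (x + h - y) + tpow (e - 1) (x - y)"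
      have "\<bar>g y\<bar> \<le> C * \<bar>y - x\<bar>"
        using near T_sub(2)[OF h(1) y] by blast
      also have "\<dots> \<le> C * (2 * \<bar>h\<bar>)"
        using y C by (intro mult_left_mono) (auto simp: T_def)
      finally have gy: "\<bar>g y\<bar> \<le> C * (2 * \<bar>h\<bar>)" .
      have "\<bar>tpow (e - 1) (x + h - y) - tpow (e - 1) (x - y)\<bar> \<le> ?s"
        using tpow_nonneg[of "e - 1" "x + h - y"] tpow_nonneg[of "e - 1" "x - y"] by simp
      then have "norm (q h y) \<le> ?s / \<bar>h\<bar> * (C * (2 * \<bar>h\<bar>))"
        unfolding q_def real_norm_def abs_mult abs_divide using gy
        by (intro mult_mono divide_right_mono) (auto simp: tpow_nonneg)
      also have "\<dots> = ?B y"
        using h(2) by simp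
      finally show "norm (q h y) \<le> ?B y" .
    qed (use B in \<open>auto simp: absolutely_integrable_on_def\<close>)
    also have "\<dots> = 2 * C * (?K (x + h) + ?K x)"
      using B by (rule integral_unique)
    \<comment> \<open>The distances from the left end of \<open>T h\<close> to \<open>x + h\<close>
      and to \<open>x\<close> are \<open>h + 2 * \<bar>h\<bar>\<close> and
      \<open>2 * \<bar>h\<bar>\<close>, both at most \<open>3 * \<bar>h\<bar>\<close>.\<close>
    also have "\<dots> \<le> 2 * C * ((3 * \<bar>h\<bar>) powr e / e + (3 * \<bar>h\<bar>) powr e / e)"
      using C e by (intro mult_left_mono add_mono divide_right_mono powr_mono2) auto
    finally show ?thesis
      by simp
  qed
  have "((\<lambda>h. (J (x + h) - J x) / h) \<longlongrightarrow> (e - 1) * integral S (\<lambda>y. tpow (e - 2) (x - y) * g y)) (at 0 within U)"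
    unfolding tendsto_at_iff_sequentially comp_def
  proof (intro allI impI)
    fix h :: "nat \<Rightarrow> real" assume "\<forall>n. h n \<in> U - {0}" and h0: "h \<longlonglongrightarrow> 0"
    then have h: "h n \<in> U" "h n \<noteq> 0" for n
      by auto
    have h_at: "filterlim h (at 0) sequentially"
      using h h0 by (auto simp: filterlim_at)
    have lim1: "(\<lambda>n. integral (T (h n)) (q (h n))) \<longlonglongrightarrow> 0"
    proof (rule Lim_null_comparison)
      show "\<forall>\<^sub>F n in sequentially. norm (integral (T (h n)) (q (h n))) \<le> 4 * C * ((3 * \<bar>h n\<bar>) powr e / e)"
        using near_bound h by simp
      have "(\<lambda>n. (3 * \<bar>h n\<bar>) powr e) \<longlonglongrightarrow> (3 * \<bar>0\<bar>) powr e"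
        using e h0 by (intro tendsto_powr' tendsto_intros) auto
      then have "(\<lambda>n. (3 * \<bar>h n\<bar>) powr e) \<longlonglongrightarrow> 0"
        using e by simp
      from tendsto_mult_right_zero[OF this, of "4 * C / e"]
      show "(\<lambda>n. 4 * C * ((3 * \<bar>h n\<bar>) powr e / e)) \<longlonglongrightarrow> 0"
        by simp
    qed
    have lim2: "(\<lambda>n. integral S (\<lambda>y. if y \<in> S - T (h n) then q (h n) y else 0)) \<longlonglongrightarrow>
                integral S (\<lambda>y. (e - 1) * (tpow (e - 2) (x - y) * g y))"
    proof (rule dominated_convergence(2))
      \<comment> \<open>The constant comes from the increment bound with
        \<open>p = e - 1\<close>.\<close>
      let ?H = "\<lambda>y. \<bar>e - 1\<bar> * 2 powr (2 - e) * \<bar>tpow (e - 2) (x - y) * g y\<bar>"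
      show "(\<lambda>y. if y \<in> S - T (h n) then q (h n) y else 0) integrable_on S" for n
      proof -
        have "q (h n) absolutely_integrable_on S - T (h n)"
          by (rule set_integrable_subset[OF q_int[OF h(1)]]) (auto simp: T_def S_def)
        then show ?thesis
          unfolding integrable_restrict_Int by (simp add: Int_absorb2 absolutely_integrable_on_def)
      qed
      show "?H integrable_on S"
        using sing_int by (intro integrable_on_mult_right) (auto simp: absolutely_integrable_on_def)
      show "norm (if y \<in> S - T (h n) then q (h n) y else 0) \<le> ?H y" for n y
      proof (cases "y \<in> S - T (h n)")
        case True
        then have "\<bar>x - y\<bar> \<ge> 2 * \<bar>h n\<bar>" "x - y \<noteq> 0"
          by (auto simp: T_def)
        from tpow_diff_bound[OF _ this, of "e - 1"]
        have "\<bar>tpow (e - 1) (x + h n - y) - tpow (e - 1) (x - y)\<bar>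
            \<le> \<bar>e - 1\<bar> * 2 powr (2 - e) * tpow (e - 2) (x - y) * \<bar>h n\<bar>"
          using e by (simp add: add_diff_eq add.commute diff_add_eq)
        then have "\<bar>tpow (e - 1) (x + h n - y) - tpow (e - 1) (x - y)\<bar> / \<bar>h n\<bar>
            \<le> \<bar>e - 1\<bar> * 2 powr (2 - e) * tpow (e - 2) (x - y)"
          using h(2)[of n] by (simp add: divide_le_eq)
        then have "\<bar>q (h n) y\<bar> \<le> \<bar>e - 1\<bar> * 2 powr (2 - e) * tpow (e - 2) (x - y) * \<bar>g y\<bar>"
          unfolding q_def abs_mult abs_divide by (intro mult_right_mono) auto
        then show ?thesis
          using True by (simp add: abs_mult tpow_nonneg mult.assoc)
      qed auto
      show "(\<lambda>n. if y \<in> S - T (h n) then q (h n) y else 0) \<longlonglongrightarrow> (e - 1) * (tpow (e - 2) (x - y) * g y)"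
        if y: "y \<in> S" for y
      \<comment> \<open>At \<open>y = x\<close> the kernel need not be differentiable, but
        \<open>x\<close> lies in every window and \<open>tpow\<close> vanishes at 0, so the sequence
        and its limit are both 0.\<close>
      proof (cases "y = x")
        case True
        then show ?thesis
          by (simp add: T_def tpow_def)
      next
        case False
        have "((\<lambda>k. (tpow (e - 1) (x - y + k) - tpow (e - 1) (x - y)) / k) \<longlongrightarrow>
               (e - 1) * tpow (e - 1 - 1) (x - y)) (at 0)"
          using tpow_has_real_derivative[of "x - y" "e - 1"] False by (simp add: DERIV_def)
        from filterlim_compose[OF this h_at]
        have "(\<lambda>n. (tpow (e - 1) (x - y + h n) - tpow (e - 1) (x - y)) / h n * g y) \<longlonglongrightarrow>
               (e - 1) * tpow (e - 1 - 1) (x - y) * g y"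
          by (rule tendsto_mult_right)
        then have "(\<lambda>n. q (h n) y) \<longlonglongrightarrow> (e - 1) * (tpow (e - 2) (x - y) * g y)"
          by (simp add: q_def add_diff_eq add.commute diff_add_eq mult.assoc)
        \<comment> \<open>A fixed \<open>y\<close> other than \<open>x\<close> eventually leaves the
          shrinking windows.\<close>
        moreover have "\<forall>\<^sub>F n in sequentially. q (h n) y = (if y \<in> S - T (h n) then q (h n) y else 0)"
        proof -
          have "\<forall>\<^sub>F n in sequentially. \<bar>h n\<bar> < \<bar>y - x\<bar> / 2"
            using False tendstoD[OF h0, of "\<bar>y - x\<bar> / 2"] by (simp add: dist_real_def)
          then show ?thesis
            using y by (auto elim!: eventually_mono simp: T_def abs_if split: if_splits)
        qed
        ultimately show ?thesis
          by (rule Lim_transform_eventually)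
      qed
    qed
    have "integral S (\<lambda>y. (e - 1) * (tpow (e - 2) (x - y) * g y)) =
          (e - 1) * integral S (\<lambda>y. tpow (e - 2) (x - y) * g y)"
      by simp
    with tendsto_add[OF lim1 lim2] show
      "(\<lambda>n. (J (x + h n) - J x) / h n) \<longlonglongrightarrow> (e - 1) * integral S (\<lambda>y. tpow (e - 2) (x - y) * g y)"
      using h by (simp add: J_diff)
  qed
  moreover have "at 0 within U = at (0::real)"
    using r by (intro at_within_open) (auto simp: U_def)
  ultimately show ?thesis
    unfolding DERIV_def J_def S_def by simp
qed

section \<open>Concentration of the kernel at the endpoint\<close>

lemma has_real_derivative_error_bound:
  fixes f :: "real \<Rightarrow> real"
  assumes "(f has_real_derivative m) (at x)" "\<eta> > 0"
  obtains d where "d > 0" "\<And>y. \<bar>y - x\<bar> < d \<Longrightarrow> \<bar>f y - f x - m * (y - x)\<bar> \<le> \<eta> * \<bar>y - x\<bar>"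
  using assms unfolding has_field_derivative_def has_derivative_at_alt by force

text \<open>Write \<open>g y = - m * (x - y) + r y\<close> with
  \<open>r y = o(\<bar>x - y\<bar>)\<close>. The linear part contributes exactly
  \<open>- m * (x - a) powr e\<close>, which tends to \<open>- m\<close>; the remainder is
  negligible near \<open>x\<close> because its constant is small, and away from \<open>x\<close>
  because of the factor \<open>e\<close>.\<close>

lemma tendsto_mult_integral_tpow:
  fixes a b x m :: real and g :: "real \<Rightarrow> real"
  assumes g: "g absolutely_integrable_on {a<..<b}" and x: "a < x" "x < b"
    and m: "(g has_real_derivative m) (at x)" and gx: "g x = 0"
  shows "((\<lambda>e. e * integral {a<..<b} (\<lambda>y. tpow (e - 2) (x - y) * g y)) \<longlongrightarrow> - m) (at_right 0)"
proof -
  define r where "r = (\<lambda>y. g y + m * (x - y))"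
  define R where "R = (\<lambda>e. integral {a<..<b} (\<lambda>y. tpow (e - 2) (x - y) * r y))"
  define N where "N = integral {a<..<b} (\<lambda>y. \<bar>r y\<bar>)"
  have ev: "\<forall>\<^sub>F e in at_right 0. e \<in> {0<..<1::real}"
    by (rule eventually_at_right_real) simp
  \<comment> \<open>The form \<open>e + k\<close> lets one rule serve the exponents \<open>e\<close>
    and \<open>e - 2\<close>; hence \<open>e + 0\<close> and \<open>e + (- 2)\<close> below.\<close>
  have pow: "((\<lambda>e. c powr (e + k)) \<longlongrightarrow> c powr (0 + k)) (at_right 0)" if "c > 0" for c k :: real
    using that by (intro tendsto_intros) auto
  have "(\<lambda>y. m * (x - y)) absolutely_integrable_on {a<..<b}"
  proof (rule set_integrable_subset)
    show "(\<lambda>y. m * (x - y)) absolutely_integrable_on {a..b}"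
      by (intro absolutely_integrable_continuous_real continuous_intros)
  qed auto
  then have r: "r absolutely_integrable_on {a<..<b}"
    unfolding r_def using g by (intro set_integral_add(1))
  have R: "(\<lambda>y. tpow (e - 2) (x - y) * r y) absolutely_integrable_on {a<..<b} \<and>
      \<bar>R e\<bar> \<le> \<eta> * ((x - a) powr e / e) + d powr (e - 2) * N"
    if "0 < e" "e < 1" "\<eta> > 0" "d > 0" and d: "\<And>y. \<bar>y - x\<bar> < d \<Longrightarrow> \<bar>g y - g x - m * (y - x)\<bar> \<le> \<eta> * \<bar>y - x\<bar>"
    for e \<eta> d
  proof -
    have near: "\<bar>r y\<bar> \<le> \<eta> * (x - y) powr 1" if "a < y" "x - d < y" "y < x" for y
      using d[of y] that gx by (simp add: r_def algebra_simps)
    have prems: "a \<le> x" "x \<le> b" "\<eta> \<ge> 0" "e - 2 \<le> 0" "e - 2 + 1 > -1"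
      using that x by auto
    show ?thesis
      using tpow_mult_absolutely_integrable[OF r prems(1,2) that(4) prems(3) near prems(4,5)]
        integral_tpow_mult_bound[OF r prems(1,2) that(4) prems(3) near prems(4,5)]
      by (simp add: R_def N_def)
  qed
  have lim_R: "((\<lambda>e. e * R e) \<longlongrightarrow> 0) (at_right 0)"
  proof (rule tendstoI)
    fix \<kappa> :: real assume "\<kappa> > 0"
    then obtain d where d: "d > 0" "\<And>y. \<bar>y - x\<bar> < d \<Longrightarrow> \<bar>g y - g x - m * (y - x)\<bar> \<le> \<kappa> / 2 * \<bar>y - x\<bar>"
      using has_real_derivative_error_bound[OF m, of "\<kappa> / 2"] by auto
    \<comment> \<open>The limit is \<open>\<kappa> / 2\<close>, which leaves room for the strict
      bound \<open>\<kappa>\<close>.\<close>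
    have "((\<lambda>e. \<kappa> / 2 * (x - a) powr (e + 0) + e * (d powr (e + (- 2)) * N)) \<longlongrightarrow>
           \<kappa> / 2 * (x - a) powr (0 + 0) + 0 * (d powr (0 + (- 2)) * N)) (at_right 0)"
      using x d by (intro tendsto_intros pow) auto
    then have "\<forall>\<^sub>F e in at_right 0. \<kappa> / 2 * (x - a) powr e + e * (d powr (e - 2) * N) < \<kappa>"
      using \<open>\<kappa> > 0\<close> x by (intro order_tendstoD(2)[where y = "\<kappa> / 2"]) simp_all
    then show "\<forall>\<^sub>F e in at_right 0. dist (e * R e) 0 < \<kappa>"
      using ev
    proof eventually_elim
      case (elim e)
      have "\<bar>e * R e\<bar> = e * \<bar>R e\<bar>"
        using elim by (simp add: abs_mult)
      also have "\<dots> \<le> e * (\<kappa> / 2 * ((x - a) powr e / e) + d powr (e - 2) * N)"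
        using R[of e "\<kappa> / 2" d] d \<open>\<kappa> > 0\<close> elim by (intro mult_left_mono) auto
      also have "\<dots> = \<kappa> / 2 * (x - a) powr e + e * (d powr (e - 2) * N)"
        using elim by (simp add: field_simps)
      finally show ?case
        using elim by simp
    qed
  qed
  have split: "e * integral {a<..<b} (\<lambda>y. tpow (e - 2) (x - y) * g y) = e * R e - m * (x - a) powr (e + 0)"
    if e: "e \<in> {0<..<1}" for e
  proof -
    \<comment> \<open>Smallness is irrelevant here: only integrability of the remainder term is
      wanted, so the error constant 1 suffices.\<close>
    obtain d where "d > 0" "\<And>y. \<bar>y - x\<bar> < d \<Longrightarrow> \<bar>g y - g x - m * (y - x)\<bar> \<le> 1 * \<bar>y - x\<bar>"
      using has_real_derivative_error_bound[OF m, of 1] by auto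
    then have "(\<lambda>y. tpow (e - 2) (x - y) * r y) absolutely_integrable_on {a<..<b}"
      using R[of e 1 d] e by auto
    then have "((\<lambda>y. tpow (e - 2) (x - y) * r y - m * tpow (e - 1) (x - y)) has_integral
        R e - m * ((x - a) powr (e - 1 + 1) / (e - 1 + 1))) {a<..<b}"
      unfolding R_def using e x
      by (intro has_integral_diff has_integral_mult_right has_integral_tpow_greaterThanLessThan
          integrable_integral) (auto simp: absolutely_integrable_on_def)
    moreover have "tpow (e - 2) (x - y) * r y - m * tpow (e - 1) (x - y) = tpow (e - 2) (x - y) * g y" for y
    proof -
      have "tpow (e - 2) (x - y) * (x - y) = tpow (e - 1) (x - y)"
        using powr_mult_base[of "x - y" "e - 2"] by (simp add: tpow_def mult.commute)
      then have "m * (tpow (e - 2) (x - y) * (x - y)) = m * tpow (e - 1) (x - y)"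
        by simp
      then show ?thesis
        by (simp add: r_def algebra_simps)
    qed
    ultimately have "integral {a<..<b} (\<lambda>y. tpow (e - 2) (x - y) * g y) = R e - m * ((x - a) powr e / e)"
      by (simp add: integral_unique)
    then show ?thesis
      using e by (simp add: field_simps)
  qed
  have "((\<lambda>e. e * R e - m * (x - a) powr (e + 0)) \<longlongrightarrow> 0 - m * (x - a) powr (0 + 0)) (at_right 0)"
    using x by (intro tendsto_diff lim_R tendsto_mult_left pow) auto
  then have "((\<lambda>e. e * R e - m * (x - a) powr (e + 0)) \<longlongrightarrow> - m) (at_right 0)"
    using x by simp
  then show ?thesis
    by (rule Lim_transform_eventually) (use ev split in \<open>auto elim: eventually_mono\<close>)
qed

section \<open>Fractional kernel integrals of causal functions\<close>

text \<open>Differentiability at \<open>z\<close> makes \<open>f\<close> continuous, hence bounded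
  near \<open>z\<close>, and the exponent \<open>e - 1\<close> is integrable there.\<close>

lemma causal_space_kernel_absolutely_integrable:
  assumes f: "f \<in> causal_space a" and z: "a < z" "z \<le> b" and e: "0 < e" "e < 1"
  shows "(\<lambda>y. tpow (e - 1) (z - y) * f y) absolutely_integrable_on {a<..<b}"
proof -
  have "isCont f z"
    using f z by (auto simp: causal_space_def intro: differentiable_imp_continuous_within)
  then obtain d where d: "d > 0" "\<And>y. \<bar>y - z\<bar> < d \<Longrightarrow> \<bar>f y - f z\<bar> < 1"
    unfolding continuous_at_eps_delta dist_real_def by (meson zero_less_one)
  show ?thesis
  proof (rule tpow_mult_absolutely_integrable[where d = d and q = 0 and M = "\<bar>f z\<bar> + 1"])
    show "\<bar>f y\<bar> \<le> (\<bar>f z\<bar> + 1) * (z - y) powr 0" if "z - d < y" "y < z" for y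
      using d(2)[of y] that by simp
  qed (use f z e d in \<open>auto simp: causal_space_def\<close>)
qed

text \<open>The truncated kernel vanishes beyond \<open>z\<close>, so the upper limit may be
  replaced by a fixed \<open>b\<close>; this prepares differentiation in \<open>z\<close>.\<close>

lemma causal_space_frac_kernel:
  assumes f: "f \<in> causal_space a" and z: "a < z" "z \<le> b" and e: "0 < e" "e < 1"
  shows causal_space_frac_kernel_integrable:
      "set_integrable lebesgue {a<..<z} (\<lambda>y. (z - y) powr (- (1 - e)) * f y)"
    and frac_kernel_integral_eq_integral:
      "frac_kernel_integral a (1 - e) f z = integral {a<..<b} (\<lambda>y. tpow (e - 1) (z - y) * f y)"
proof -
  have "(\<lambda>y. tpow (e - 1) (z - y) * f y) absolutely_integrable_on {a<..<z}"
    using causal_space_kernel_absolutely_integrable[OF f z(1) _ e] by simp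
  then show int: "set_integrable lebesgue {a<..<z} (\<lambda>y. (z - y) powr (- (1 - e)) * f y)"
    by (rule set_integrable_cong[THEN iffD1, rotated -1]) (auto simp: tpow_def)
  have "integral {a<..<b} (\<lambda>y. tpow (e - 1) (z - y) * f y) =
        integral {a<..<b} (\<lambda>y. if y \<in> {a<..<z} then (z - y) powr (- (1 - e)) * f y else 0)"
    by (intro integral_cong) (auto simp: tpow_def)
  also have "\<dots> = integral {a<..<z} (\<lambda>y. (z - y) powr (- (1 - e)) * f y)"
    using z unfolding integral_restrict_Int by (subst Int_absorb2) auto
  finally show "frac_kernel_integral a (1 - e) f z = integral {a<..<b} (\<lambda>y. tpow (e - 1) (z - y) * f y)"
    unfolding frac_kernel_integral_def using set_lebesgue_integral_eq_integral(2)[OF int] by simp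
qed

text \<open>The constant \<open>f x\<close> integrates to \<open>f x * ((z - a) powr e / e)\<close>,
  differentiated by hand. The rest \<open>f y - f x\<close> is at most
  \<open>(\<bar>m\<bar> + 1) * \<bar>y - x\<bar>\<close> near \<open>x\<close>, by differentiability
  at \<open>x\<close>, which permits differentiation under the integral.\<close>

lemma frac_kernel_integral_has_real_derivative:
  assumes f: "f \<in> causal_space a" and x: "a < x" "x < b" and e: "0 < e" "e < 1"
  shows "(frac_kernel_integral a (1 - e) f has_real_derivative
      f x * (x - a) powr (e - 1) + (e - 1) * integral {a<..<b} (\<lambda>y. tpow (e - 2) (x - y) * (f y - f x))) (at x)"
proof -
  define g where "g = (\<lambda>y. f y - f x)"
  have "f absolutely_integrable_on {a<..<b}"
    using f x by (auto simp: causal_space_def)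
  then have g_int: "g absolutely_integrable_on {a<..<b}"
    unfolding g_def by (intro set_integral_diff(1)) (auto simp: absolutely_integrable_on_const)
  obtain m where "(f has_real_derivative m) (at x)"
    using f x by (auto simp: causal_space_def real_differentiable_def)
  then obtain d where d: "d > 0" "\<And>y. \<bar>y - x\<bar> < d \<Longrightarrow> \<bar>f y - f x - m * (y - x)\<bar> \<le> 1 * \<bar>y - x\<bar>"
    using has_real_derivative_error_bound[of f m x 1] by auto
  have "\<bar>g y\<bar> \<le> (\<bar>m\<bar> + 1) * \<bar>y - x\<bar>" if "\<bar>y - x\<bar> < d" for y
  proof -
    have "\<bar>g y\<bar> \<le> \<bar>f y - f x - m * (y - x)\<bar> + \<bar>m * (y - x)\<bar>"
      by (simp add: g_def)
    also have "\<dots> \<le> 1 * \<bar>y - x\<bar> + \<bar>m\<bar> * \<bar>y - x\<bar>"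
      using d(2)[OF that] by (intro add_mono) (auto simp: abs_mult)
    finally show ?thesis
      by (simp add: algebra_simps)
  qed
  then have Dg: "((\<lambda>z. integral {a<..<b} (\<lambda>y. tpow (e - 1) (z - y) * g y)) has_real_derivative
      (e - 1) * integral {a<..<b} (\<lambda>y. tpow (e - 2) (x - y) * g y)) (at x)"
    by (intro integral_tpow_mult_has_real_derivative[where C = "\<bar>m\<bar> + 1", OF g_int x e _ d(1)]) auto
  have "((\<lambda>z. f x * ((z - a) powr e / e)) has_real_derivative f x * (x - a) powr (e - 1)) (at x)"
    using x e by (auto intro!: derivative_eq_intros)
  from DERIV_add[OF this Dg]
  have "((\<lambda>z. f x * ((z - a) powr e / e) + integral {a<..<b} (\<lambda>y. tpow (e - 1) (z - y) * g y))
      has_real_derivative f x * (x - a) powr (e - 1) +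
      (e - 1) * integral {a<..<b} (\<lambda>y. tpow (e - 2) (x - y) * (f y - f x))) (at x)"
    by (simp add: g_def)
  then show ?thesis
  proof (rule has_field_derivative_transform_within_open[where S = "{a<..<b}"])
    fix z assume z: "z \<in> {a<..<b}"
    have k: "((\<lambda>y. tpow (e - 1) (z - y)) has_integral (z - a) powr e / e) {a<..<b}"
      using has_integral_tpow_greaterThanLessThan[of "e - 1" a z b] z e by simp
    have "(\<lambda>y. tpow (e - 1) (z - y) * f y) integrable_on {a<..<b}"
      using causal_space_kernel_absolutely_integrable[OF f _ _ e] z by (simp add: absolutely_integrable_on_def)
    then have "((\<lambda>y. tpow (e - 1) (z - y) * f y - f x * tpow (e - 1) (z - y)) has_integral
        integral {a<..<b} (\<lambda>y. tpow (e - 1) (z - y) * f y) - f x * ((z - a) powr e / e)) {a<..<b}"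
      by (intro has_integral_diff has_integral_mult_right k integrable_integral)
    moreover have "(\<lambda>y. tpow (e - 1) (z - y) * f y - f x * tpow (e - 1) (z - y)) =
        (\<lambda>y. tpow (e - 1) (z - y) * g y)"
      by (auto simp: g_def algebra_simps)
    ultimately have "integral {a<..<b} (\<lambda>y. tpow (e - 1) (z - y) * g y) =
        integral {a<..<b} (\<lambda>y. tpow (e - 1) (z - y) * f y) - f x * ((z - a) powr e / e)"
      by (simp add: integral_unique)
    then show "f x * ((z - a) powr e / e) + integral {a<..<b} (\<lambda>y. tpow (e - 1) (z - y) * g y) =
        frac_kernel_integral a (1 - e) f z"
      using frac_kernel_integral_eq_integral[OF f, of z b e] z e by simp
  qed (use x in auto)
qed

section \<open>Limit of the fractional derivatives\<close>

theorem theorem5: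
  fixes a x :: real and f :: "real \<Rightarrow> real"
  assumes "f \<in> causal_space a" and "x > a"
  shows "(\<forall>\<epsilon>\<in>{0<..<1}. frac_deriv_exists a (1 - \<epsilon>) f x) \<and>
         ((\<lambda>\<epsilon>. frac_deriv a (1 - \<epsilon>) f x) \<longlongrightarrow> deriv f x) (at_right 0)"
proof (intro conjI ballI)
  define I where "I = (\<lambda>e. integral {a<..<x + 1} (\<lambda>y. tpow (e - 2) (x - y) * (f y - f x)))"
  have D: "(frac_kernel_integral a (1 - e) f has_real_derivative f x * (x - a) powr (e - 1) + (e - 1) * I e) (at x)"
    if "e \<in> {0<..<1}" for e
    using frac_kernel_integral_has_real_derivative[OF assms, of "x + 1" e] that by (simp add: I_def)
  show "frac_deriv_exists a (1 - e) f x" if "e \<in> {0<..<1}" for e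
    unfolding frac_deriv_exists_def
    using D[OF that] causal_space_frac_kernel_integrable[OF assms(1) _ order_refl] that
    by (auto simp: real_differentiable_def)
  have "f differentiable (at x)"
    using assms by (auto simp: causal_space_def)
  then have m: "(f has_real_derivative deriv f x) (at x)"
    by (simp add: DERIV_deriv_iff_real_differentiable)
  have "f absolutely_integrable_on {a<..<x + 1}"
    using assms by (auto simp: causal_space_def)
  then have "(\<lambda>y. f y - f x) absolutely_integrable_on {a<..<x + 1}"
    by (intro set_integral_diff(1)) (auto simp: absolutely_integrable_on_const)
  then have I: "((\<lambda>e. e * I e) \<longlongrightarrow> - deriv f x) (at_right 0)"
    unfolding I_def using assms(2) m
    by (intro tendsto_mult_integral_tpow) (auto intro!: derivative_eq_intros)
  \<comment> \<open>Writing \<open>1 / Gamma e\<close> as \<open>e * rGamma (e + 1)\<close> isolates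
    the factor \<open>e\<close> that tames \<open>I e\<close> and kills the boundary term;
    \<open>rGamma\<close> is continuous at 1 with value 1.\<close>
  have G: "((\<lambda>e. rGamma (e + 1)) \<longlongrightarrow> rGamma (0 + 1 :: real)) (at_right 0)"
    by (intro isCont_tendsto_compose[of _ rGamma] isCont_rGamma[OF continuous_ident] tendsto_intros)
  have "((\<lambda>e. rGamma (e + 1) * (e * (f x * (x - a) powr (e - 1)) + (e - 1) * (e * I e))) \<longlongrightarrow>
      rGamma (0 + 1) * (0 * (f x * (x - a) powr (0 - 1)) + (0 - 1) * (- deriv f x))) (at_right 0)"
    using assms(2) by (intro tendsto_intros I G) auto
  then have "((\<lambda>e. rGamma (e + 1) * (e * (f x * (x - a) powr (e - 1)) + (e - 1) * (e * I e))) \<longlongrightarrow>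
      deriv f x) (at_right 0)"
    by simp
  moreover have "\<forall>\<^sub>F e in at_right 0. rGamma (e + 1) * (e * (f x * (x - a) powr (e - 1)) + (e - 1) * (e * I e)) =
      frac_deriv a (1 - e) f x"
    using eventually_at_right_real[OF zero_less_one]
  proof eventually_elim
    case (elim e)
    have "frac_deriv a (1 - e) f x = rGamma e * (f x * (x - a) powr (e - 1) + (e - 1) * I e)"
      using DERIV_imp_deriv[OF D[OF elim]] by (simp add: frac_deriv_def rGamma_inverse_Gamma divide_inverse)
    also have "rGamma e = e * rGamma (e + 1)"
      by (simp add: rGamma_plus1)
    finally show ?case
      by (simp add: algebra_simps)
  qed
  ultimately show "((\<lambda>e. frac_deriv a (1 - e) f x) \<longlongrightarrow> deriv f x) (at_right 0)"
    by (rule Lim_transform_eventually)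
qed

end
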